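(* Let $\lambda\ge\omega_1$ be a cardinal and let $k\in\omega$. Then every hypergraph $\mathcal E\subseteq[\lambda]^{\omega_1}$ (i.e. every edge is a subset of $\lambda$ of cardinality $\omega_1$) possessing property $C(3,k)$ has a minimal vertex cover.
   Context: A hypergraph is identified with a family $\mathcal E$ of non-empty sets (its edges); its vertex set is $\bigcup\mathcal E$. $[\lambda]^{\omega_1}$ denotes the set of subsets of $\lambda$ of cardinality exactly $\omega_1$. A hypergraph $\mathcal E$ possesses property $C(m,\rho)$ iff $|\bigcap\mathcal E'|<\rho$ for every set $\mathcal E'\subseteq\mathcal E$ of exactly $m$ distinct edges (so $C(3,k)$: any three distinct edges have fewer than $k$ common elements). A set $Y\subseteq\bigcup\mathcal E$ is a vertex cover of $\mathcal E$ iff $Y\cap E\neq\emptyset$ for every $E\in\mathcal E$; it is a minimal vertex cover iff no proper subset of $Y$ is a vertex cover. *)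

theory Defs
  imports Main
begin

unbundle cardinal_syntax

text \<open>
  Cardinals are the well-order relations satisfying \<^const>\<open>Card_order\<close>; a cardinal
  \<open>r\<close>, regarded as a set (of ordinals), is \<^term>\<open>Field r\<close>.
\<close>

abbreviation omega1 :: "nat set rel" (\<open>\<omega>\<^sub>1\<close>)
  where "\<omega>\<^sub>1 \<equiv> cardSuc natLeq"

definition subsets_of_card :: "'a rel \<Rightarrow> 'b rel \<Rightarrow> 'a set set"
  where "subsets_of_card lam mu = {A. A \<subseteq> Field lam \<and> |A| =o mu}"

definition hypergraph :: "'a set set \<Rightarrow> bool"
  where "hypergraph \<E> \<longleftrightarrow> {} \<notin> \<E>"

text \<open>
  The parameters \<open>m\<close> and \<open>\<rho>\<close> of the property \<open>C(m, \<rho>)\<close> are arbitrary cardinals; a natural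
  number \<open>n\<close> is passed as \<^term>\<open>|{..<n::nat}|\<close>. Note that \<^term>\<open>\<Inter>{} = UNIV\<close>, so the
  definition is meaningful for \<open>m \<noteq> 0\<close> only.
\<close>

definition property_C :: "'m rel \<Rightarrow> 'r rel \<Rightarrow> 'a set set \<Rightarrow> bool"
  where "property_C m \<rho> \<E> \<longleftrightarrow> (\<forall>\<E>'\<subseteq>\<E>. |\<E>'| =o m \<longrightarrow> |\<Inter>\<E>'| <o \<rho>)"

definition vertex_cover :: "'a set set \<Rightarrow> 'a set \<Rightarrow> bool"
  where "vertex_cover \<E> Y \<longleftrightarrow> Y \<subseteq> \<Union>\<E> \<and> (\<forall>E\<in>\<E>. Y \<inter> E \<noteq> {})"

definition minimal_vertex_cover :: "'a set set \<Rightarrow> 'a set \<Rightarrow> bool"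
  where "minimal_vertex_cover \<E> Y \<longleftrightarrow>
    vertex_cover \<E> Y \<and> (\<forall>Z. Z \<subset> Y \<longrightarrow> \<not> vertex_cover \<E> Z)"

lemma card_of_eq_finite_iff:
  "|A| =o |{..<n::nat}| \<longleftrightarrow> finite A \<and> card A = n"
proof
  assume "|A| =o |{..<n}|"
  then obtain f where "bij_betw f A {..<n}"
    using card_of_ordIso by blast
  then show "finite A \<and> card A = n"
    using bij_betw_finite bij_betw_same_card by fastforce
next
  assume "finite A \<and> card A = n"
  then obtain f where "bij_betw f A {..<n}"
    by (metis card_lessThan finite_lessThan finite_same_card_bij)
  then show "|A| =o |{..<n}|"
    using card_of_ordIso by blast
qed

lemma card_of_less_finite_iff:
  "|A| <o |{..<n::nat}| \<longleftrightarrow> finite A \<and> card A < n"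
proof -
  have "|A| <o |{..<n}| \<longleftrightarrow> \<not> (\<exists>f. inj_on f {..<n} \<and> f ` {..<n} \<subseteq> A)"
    using card_of_ordLess[of "{..<n}" A] by blast
  also have "\<dots> \<longleftrightarrow> finite A \<and> card A < n"
  proof (cases "finite A")
    case True
    then show ?thesis
      by (metis card_inj_on_le card_le_inj card_lessThan finite_lessThan linorder_not_le)
  next
    case False
    then obtain B where "B \<subseteq> A" "finite B" "card B = n"
      using infinite_arbitrarily_large by blast
    then obtain f where "bij_betw f {..<n} B"
      by (metis card_lessThan finite_lessThan finite_same_card_bij)
    with \<open>B \<subseteq> A\<close> False show ?thesis
      by (metis bij_betw_def)
  qed
  finally show ?thesis .
qed

lemma property_C_finite_iff:
  "property_C |{..<m::nat}| |{..<k::nat}| \<E> \<longleftrightarrow>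
    (\<forall>\<E>'\<subseteq>\<E>. finite \<E>' \<and> card \<E>' = m \<longrightarrow> finite (\<Inter>\<E>') \<and> card (\<Inter>\<E>') < k)"
  unfolding property_C_def card_of_eq_finite_iff card_of_less_finite_iff ..

end

theory Submission
  imports Defs "HOL-Library.Countable_Set_Type"
begin

text \<open>
  Since \<open>k\<close> points lie in at most two edges, closing a subfamily under ``an edge with \<open>k\<close>
  points in the union of the subfamily belongs to it'' adds at most \<open>\<omega>\<^sub>1\<close> edges beyond its
  cardinality, and every edge outside the closure meets the union of the closure in a finite
  set. A family of more than \<open>\<omega>\<^sub>1\<close> edges is thus exhausted by an increasing well-ordered sequence
  of smaller closed subfamilies. Going along this sequence, one covers the edges not yet hit
  by a minimal cover that avoids the union of the preceding subfamilies; discarding that union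
  costs each new edge only finitely many points, so the induction hypothesis applies.

  For at most \<open>\<omega>\<^sub>1\<close> edges, join two edges if their intersection is uncountable and choose
  disjoint stars covering the non-isolated edges. Going through the edges in type \<open>\<omega>\<^sub>1\<close>, an edge
  not yet hit gets a point of an isolated edge or of the intersection of a leaf with its centre;
  uncountably many points are available there, while the countably many edges reserved before
  rule out only countably many of them.
\<close>

section \<open>Bounded triple intersections and minimal covers via private edges\<close>

definition triple_bounded :: "nat \<Rightarrow> 'a set set \<Rightarrow> bool"
  where "triple_bounded k \<E> \<longleftrightarrow> (\<forall>A\<in>\<E>. \<forall>B\<in>\<E>. \<forall>C\<in>\<E>. A \<noteq> B \<longrightarrow> A \<noteq> C \<longrightarrow> B \<noteq> C \<longrightarrow>
    finite (A \<inter> B \<inter> C) \<and> card (A \<inter> B \<inter> C) < k)"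

lemma triple_boundedD:
  assumes "triple_bounded k \<E>" "A \<in> \<E>" "B \<in> \<E>" "C \<in> \<E>" "A \<noteq> B" "A \<noteq> C" "B \<noteq> C"
  shows "finite (A \<inter> B \<inter> C)" "card (A \<inter> B \<inter> C) < k"
  using assms unfolding triple_bounded_def by simp_all

lemma triple_bounded_mono:
  assumes "triple_bounded k \<E>" "k \<le> l"
  shows "triple_bounded l \<E>"
  using assms unfolding triple_bounded_def by (meson order_less_le_trans)

text \<open>Distinct truncations come from distinct edges, and truncating only shrinks
  intersections. This lets the induction hypothesis be applied to truncated edges, some of which may
  have been identified.\<close>

lemma triple_bounded_truncate:
  assumes "triple_bounded k \<E>" "S \<subseteq> \<E>"
  shows "triple_bounded k ((\<lambda>E. E - U) ` S)"
  unfolding triple_bounded_def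
proof (intro ballI impI)
  fix A B C
  assume "A \<in> (\<lambda>E. E - U) ` S" "B \<in> (\<lambda>E. E - U) ` S" "C \<in> (\<lambda>E. E - U) ` S"
    and ne: "A \<noteq> B" "A \<noteq> C" "B \<noteq> C"
  then obtain A' B' C' where *: "A' \<in> S" "B' \<in> S" "C' \<in> S"
    "A = A' - U" "B = B' - U" "C = C' - U" by blast
  have "A' \<noteq> B'" "A' \<noteq> C'" "B' \<noteq> C'" using ne * by auto
  with * assms(2) have fin: "finite (A' \<inter> B' \<inter> C')" "card (A' \<inter> B' \<inter> C') < k"
    using triple_boundedD[OF assms(1), of A' B' C'] by blast+
  have sub: "A \<inter> B \<inter> C \<subseteq> A' \<inter> B' \<inter> C'" using * by blast
  show "finite (A \<inter> B \<inter> C) \<and> card (A \<inter> B \<inter> C) < k"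
    using finite_subset[OF sub fin(1)] card_mono[OF fin(1) sub] fin(2) by simp
qed

lemma triple_bounded_if_property_C:
  assumes "property_C |{..<3::nat}| |{..<k::nat}| \<E>"
  shows "triple_bounded k \<E>"
  unfolding triple_bounded_def
proof (intro ballI impI)
  fix A B C
  assume "A \<in> \<E>" "B \<in> \<E>" "C \<in> \<E>" "A \<noteq> B" "A \<noteq> C" "B \<noteq> C"
  then have "{A, B, C} \<subseteq> \<E>" "finite {A, B, C} \<and> card {A, B, C} = 3" by auto
  with assms have "finite (\<Inter>{A, B, C}) \<and> card (\<Inter>{A, B, C}) < k"
    unfolding property_C_finite_iff by blast
  then show "finite (A \<inter> B \<inter> C) \<and> card (A \<inter> B \<inter> C) < k"
    by (simp add: Int_assoc)
qed

text \<open>Removing \<open>y\<close> uncovers an edge that meets \<open>Y\<close> in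
  \<open>y\<close> alone. Both constructions below obtain minimality from such private
  edges.\<close>

lemma minimal_vertex_coverI:
  assumes "Y \<subseteq> \<Union>\<E>" "\<And>E. E \<in> \<E> \<Longrightarrow> Y \<inter> E \<noteq> {}"
    and "\<And>y. y \<in> Y \<Longrightarrow> \<exists>E\<in>\<E>. Y \<inter> E = {y}"
  shows "minimal_vertex_cover \<E> Y"
  unfolding minimal_vertex_cover_def vertex_cover_def
proof (intro conjI allI impI notI)
  fix Z
  assume "Z \<subset> Y" and Z: "Z \<subseteq> \<Union>\<E> \<and> (\<forall>E\<in>\<E>. Z \<inter> E \<noteq> {})"
  then obtain y where "y \<in> Y" "y \<notin> Z" by blast
  then obtain E where "E \<in> \<E>" "Y \<inter> E = {y}" using assms(3) by metis
  moreover have "Z \<inter> E \<subseteq> Y \<inter> E - {y}" using \<open>Z \<subset> Y\<close> \<open>y \<notin> Z\<close> by blast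
  ultimately have "E \<in> \<E>" "Z \<inter> E = {}" by auto
  then show False using Z \<open>E \<in> \<E>\<close> by simp
qed (use assms(1,2) in simp_all)

lemma minimal_vertex_coverD:
  assumes "minimal_vertex_cover \<E> Y"
  shows "Y \<subseteq> \<Union>\<E>" "E \<in> \<E> \<Longrightarrow> Y \<inter> E \<noteq> {}" "y \<in> Y \<Longrightarrow> \<exists>E\<in>\<E>. Y \<inter> E = {y}"
proof -
  show "Y \<subseteq> \<Union>\<E>" and hit: "E \<in> \<E> \<Longrightarrow> Y \<inter> E \<noteq> {}" for E
    using assms unfolding minimal_vertex_cover_def vertex_cover_def by blast+
  assume y: "y \<in> Y"
  then have "Y - {y} \<subset> Y" by blast
  then have "\<not> vertex_cover \<E> (Y - {y})"
    using assms unfolding minimal_vertex_cover_def by simp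
  with \<open>Y \<subseteq> \<Union>\<E>\<close> obtain E where "E \<in> \<E>" "(Y - {y}) \<inter> E = {}"
    unfolding vertex_cover_def by blast
  with hit[of E] show "\<exists>E\<in>\<E>. Y \<inter> E = {y}" by blast
qed

section \<open>Star forests\<close>

text \<open>Zorn's lemma on sets of disjoint pairs. Pairs are ordered so that each has a
  distinguished end; disjointness rules out having both \<open>(a, b)\<close> and
  \<open>(b, a)\<close>. Maximality gives the last clause: two adjacent unmatched vertices would
  form a further pair.\<close>

lemma maximal_matching:
  fixes R :: "'v \<Rightarrow> 'v \<Rightarrow> bool"
  obtains M where "M \<subseteq> V \<times> V" "\<And>a b. (a, b) \<in> M \<Longrightarrow> a \<noteq> b \<and> R a b"
    "\<And>a b c d. (a, b) \<in> M \<Longrightarrow> (c, d) \<in> M \<Longrightarrow> {a, b} \<inter> {c, d} \<noteq> {} \<Longrightarrow> a = c \<and> b = d"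
    "\<And>u v. u \<in> V - (fst ` M \<union> snd ` M) \<Longrightarrow> v \<in> V - (fst ` M \<union> snd ` M) \<Longrightarrow> u \<noteq> v \<Longrightarrow> \<not> R u v"
proof -
  define matching where "matching M \<longleftrightarrow> M \<subseteq> V \<times> V \<and> (\<forall>a b. (a, b) \<in> M \<longrightarrow> a \<noteq> b \<and> R a b) \<and>
    (\<forall>a b c d. (a, b) \<in> M \<longrightarrow> (c, d) \<in> M \<longrightarrow> {a, b} \<inter> {c, d} \<noteq> {} \<longrightarrow> a = c \<and> b = d)" for M
  have mV: "M \<subseteq> V \<times> V" and mR: "\<And>a b. (a, b) \<in> M \<Longrightarrow> a \<noteq> b \<and> R a b"
    and mD: "\<And>a b c d. (a, b) \<in> M \<Longrightarrow> (c, d) \<in> M \<Longrightarrow> {a, b} \<inter> {c, d} \<noteq> {} \<Longrightarrow> a = c \<and> b = d"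
    if "matching M" for M
  proof -
    show "M \<subseteq> V \<times> V" using that unfolding matching_def by (elim conjE)
    show "a \<noteq> b \<and> R a b" if "(a, b) \<in> M" for a b
      using \<open>matching M\<close> that unfolding matching_def by (elim conjE) metis
    show "a = c \<and> b = d" if "(a, b) \<in> M" "(c, d) \<in> M" "{a, b} \<inter> {c, d} \<noteq> {}" for a b c d
      using \<open>matching M\<close> that unfolding matching_def by (elim conjE) metis
  qed
  have "\<exists>M\<in>Collect matching. \<forall>X\<in>Collect matching. M \<subseteq> X \<longrightarrow> X = M"
  proof (rule subset_Zorn')
    fix \<C> assume ch: "subset.chain (Collect matching) \<C>"
    then have m: "matching X" if "X \<in> \<C>" for X
      using that by (auto simp: subset_chain_def)
    \<comment> \<open>The matching conditions involve at most two pairs at a time, so they pass to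
      the union once both pairs lie in one member of the chain.\<close>
    have common: "\<exists>X\<in>\<C>. p \<in> X \<and> q \<in> X" if "p \<in> \<Union>\<C>" "q \<in> \<Union>\<C>" for p q
    proof -
      from that obtain X X' where "X \<in> \<C>" "p \<in> X" "X' \<in> \<C>" "q \<in> X'" by blast
      moreover from this ch have "X \<subseteq> X' \<or> X' \<subseteq> X" unfolding subset_chain_def by blast
      ultimately show ?thesis by blast
    qed
    have "matching (\<Union>\<C>)"
      unfolding matching_def
    proof (intro conjI allI impI)
      show "\<Union>\<C> \<subseteq> V \<times> V" using mV[OF m] by blast
    next
      fix a b assume "(a, b) \<in> \<Union>\<C>"
      then show "a \<noteq> b" "R a b" using mR[OF m] by blast+
    next
      fix a b c d
      assume ab: "(a, b) \<in> \<Union>\<C>" and cd: "(c, d) \<in> \<Union>\<C>" and ne: "{a, b} \<inter> {c, d} \<noteq> {}"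
      from common[OF ab cd] obtain X where "X \<in> \<C>" "(a, b) \<in> X" "(c, d) \<in> X" by blast
      then show "a = c" "b = d" using mD[OF m _ _ ne] by blast+
    qed
    then show "\<Union>\<C> \<in> Collect matching" by simp
  qed
  then obtain M where M: "matching M" and max: "\<And>X. matching X \<Longrightarrow> M \<subseteq> X \<Longrightarrow> X = M" by blast
  show thesis
  proof
    show "M \<subseteq> V \<times> V" by (rule mV[OF M])
    show "a \<noteq> b \<and> R a b" if "(a, b) \<in> M" for a b by (rule mR[OF M that])
    show "a = c \<and> b = d" if "(a, b) \<in> M" "(c, d) \<in> M" "{a, b} \<inter> {c, d} \<noteq> {}" for a b c d
      by (rule mD[OF M that])
    fix u v
    assume uv: "u \<in> V - (fst ` M \<union> snd ` M)" "v \<in> V - (fst ` M \<union> snd ` M)" "u \<noteq> v"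
    show "\<not> R u v"
    proof
      assume "R u v"
      have new: "a \<notin> {u, v}" "b \<notin> {u, v}" if "(a, b) \<in> M" for a b
        using uv(1,2) image_eqI[OF _ that, of _ fst] image_eqI[OF _ that, of _ snd] by auto
      have "matching (insert (u, v) M)"
        unfolding matching_def
      proof (intro conjI allI impI)
        show "insert (u, v) M \<subseteq> V \<times> V" using mV[OF M] uv by simp
      next
        fix a b assume "(a, b) \<in> insert (u, v) M"
        then show "a \<noteq> b" "R a b" using mR[OF M, of a b] uv(3) \<open>R u v\<close> by auto
      next
        fix a b c d
        assume *: "(a, b) \<in> insert (u, v) M" "(c, d) \<in> insert (u, v) M" "{a, b} \<inter> {c, d} \<noteq> {}"
        then have "(a, b) \<in> M \<and> (c, d) \<in> M \<or> a = c \<and> b = d"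
          using new[of a b] new[of c d] by auto
        then show "a = c" "b = d" using mD[OF M _ _ *(3)] by blast+
      qed
      then have "insert (u, v) M = M" using max by blast
      then show False using new by blast
    qed
  qed
qed

text \<open>The isolated vertices are the fixed points of \<open>p\<close>; the other vertices outside \<open>C\<close> are
  leaves, attached by \<open>p\<close> to their centre.\<close>

lemma star_forest:
  fixes R :: "'v \<Rightarrow> 'v \<Rightarrow> bool"
  assumes "symp R"
  shows "\<exists>C p. C \<subseteq> V \<and>
    (\<forall>v\<in>V - C. p v \<in> C \<and> R v (p v) \<or> p v = v \<and> (\<forall>w\<in>V. w \<noteq> v \<longrightarrow> \<not> R v w)) \<and>
    (\<forall>c\<in>C. \<exists>v\<in>V - C. p v = c)"
proof -
  obtain M where MV: "M \<subseteq> V \<times> V" and MR: "\<And>a b. (a, b) \<in> M \<Longrightarrow> a \<noteq> b \<and> R a b"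
    and Mdisj: "\<And>a b c d. (a, b) \<in> M \<Longrightarrow> (c, d) \<in> M \<Longrightarrow> {a, b} \<inter> {c, d} \<noteq> {} \<Longrightarrow> a = c \<and> b = d"
    and Mmax: "\<And>u v. u \<in> V - (fst ` M \<union> snd ` M) \<Longrightarrow> v \<in> V - (fst ` M \<union> snd ` M) \<Longrightarrow>
      u \<noteq> v \<Longrightarrow> \<not> R u v"
    by (rule maximal_matching[of V R], rule that, (assumption | metis)+)
  define cov where "cov = fst ` M \<union> snd ` M"
  define iso where "iso v \<longleftrightarrow> (\<forall>w\<in>V. w \<noteq> v \<longrightarrow> \<not> R v w)" for v
  have covV: "cov \<subseteq> V" using MV unfolding cov_def by auto
  have "\<exists>w. w \<in> cov \<and> R u w" if u: "u \<in> V - cov" "\<not> iso u" for u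
  proof -
    obtain w where "w \<in> V" "w \<noteq> u" "R u w" using u(2) unfolding iso_def by blast
    then have "w \<in> cov" using Mmax[of u w] u(1) unfolding cov_def by auto
    then show ?thesis using \<open>R u w\<close> by blast
  qed
  then obtain q where q: "\<And>u. u \<in> V - cov \<Longrightarrow> \<not> iso u \<Longrightarrow> q u \<in> cov \<and> R u (q u)"
    by metis
  \<comment> \<open>\<open>W\<close> holds the matched vertices to which \<open>q\<close> attaches
    unmatched ones. A pair whose second end is not in \<open>W\<close> also contributes its first
    end, so every pair has an end in \<open>C\<close>. A centre in \<open>W\<close> has an unmatched
    leaf; any other centre has its partner as a leaf.\<close>
  define W where "W = q ` {u \<in> V - cov. \<not> iso u}"
  define C where "C = W \<union> {a. \<exists>b. (a, b) \<in> M \<and> b \<notin> W}"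
  have "\<forall>v\<in>cov. \<exists>w. (v, w) \<in> M \<or> (w, v) \<in> M" unfolding cov_def by force
  then obtain m where m: "\<And>v. v \<in> cov \<Longrightarrow> (v, m v) \<in> M \<or> (m v, v) \<in> M" by metis
  define p where "p v = (if v \<in> cov then m v else if iso v then v else q v)" for v
  have Ccov: "C \<subseteq> cov"
  proof
    fix c assume "c \<in> C"
    then consider "c \<in> W" | b where "(c, b) \<in> M" unfolding C_def by blast
    then show "c \<in> cov"
    proof cases
      case 1
      then show ?thesis using q unfolding W_def by blast
    next
      case 2
      then show ?thesis unfolding cov_def by force
    qed
  qed
  show ?thesis
  proof (rule exI[of _ C], rule exI[of _ p], intro conjI ballI)
    show "C \<subseteq> V" using Ccov covV by blast
  next
    fix v assume v: "v \<in> V - C"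
    consider "v \<in> cov" | "v \<notin> cov" "iso v" | "v \<notin> cov" "\<not> iso v" by blast
    then show "p v \<in> C \<and> R v (p v) \<or> p v = v \<and> (\<forall>w\<in>V. w \<noteq> v \<longrightarrow> \<not> R v w)"
    proof cases
      case 1
      then have "p v = m v" by (simp add: p_def)
      moreover have "R v (m v)" using m[OF 1] MR sympD[OF assms] by blast
      moreover have "m v \<in> C" using m[OF 1] v unfolding C_def by blast
      ultimately show ?thesis by simp
    next
      case 2
      then show ?thesis by (simp add: p_def iso_def)
    next
      case 3
      then have "p v = q v" by (simp add: p_def)
      moreover have "q v \<in> C" using 3 v unfolding C_def W_def by blast
      ultimately show ?thesis using q 3 v by auto
    qed
  next
    fix c assume "c \<in> C"
    then consider "c \<in> W" | b where "(c, b) \<in> M" "b \<notin> W" unfolding C_def by blast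
    then show "\<exists>v\<in>V - C. p v = c"
    proof cases
      case 1
      then obtain u where "u \<in> V - cov" "\<not> iso u" "c = q u" unfolding W_def by blast
      then show ?thesis using Ccov by (intro bexI[of _ u]) (auto simp: p_def)
    next
      case 2
      have "b \<in> cov" using 2 unfolding cov_def by force
      have "b \<notin> C" using 2 Mdisj[of c b b] MR unfolding C_def by blast
      have "m b = c" using m[OF \<open>b \<in> cov\<close>] Mdisj[OF 2(1)] MR by blast
      then show ?thesis using \<open>b \<in> cov\<close> \<open>b \<notin> C\<close> covV by (intro bexI[of _ b]) (auto simp: p_def)
    qed
  qed
qed

section \<open>At most \<open>\<omega>\<^sub>1\<close> edges\<close>

text \<open>Recursion along \<open>R\<close>: an edge not yet hit adds a point of some
  \<open>L \<inter> p L\<close>, where \<open>L\<close> is a leaf or isolated. This set is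
  uncountable, yet every edge other than \<open>L\<close> and \<open>p L\<close> meets it in a
  countable set, so the countably many edges reserved earlier can be avoided.\<close>

lemma minimal_vertex_cover_countable_initial_segments:
  fixes \<E> :: "'a set set"
  assumes wf: "wf R" and trans: "trans R"
    and total: "\<And>A B. A \<in> \<E> \<Longrightarrow> B \<in> \<E> \<Longrightarrow> A \<noteq> B \<Longrightarrow> (A, B) \<in> R \<or> (B, A) \<in> R"
    and init: "\<And>A. A \<in> \<E> \<Longrightarrow> countable {B\<in>\<E>. (B, A) \<in> R}"
    and unc: "\<And>A. A \<in> \<E> \<Longrightarrow> uncountable A"
    and tb: "triple_bounded k \<E>"
  shows "\<exists>Y. minimal_vertex_cover \<E> Y"
proof -
  obtain C p where CE: "C \<subseteq> \<E>"
    and p: "\<forall>L\<in>\<E> - C. p L \<in> C \<and> uncountable (L \<inter> p L) \<or>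
      p L = L \<and> (\<forall>F\<in>\<E>. F \<noteq> L \<longrightarrow> \<not> uncountable (L \<inter> F))"
    and onto: "\<forall>c\<in>C. \<exists>L\<in>\<E> - C. p L = c"
  proof -
    have "symp (\<lambda>A B :: 'a set. uncountable (A \<inter> B))"
      by (simp add: symp_def Int_commute)
    from star_forest[OF this, of \<E>] show thesis by (elim exE conjE) (rule that)
  qed
  note p = p[rule_format]
  have pE: "p L \<in> \<E>" if "L \<in> \<E> - C" for L using p[OF that] that CE by auto
  have big: "uncountable (L \<inter> p L)" if "L \<in> \<E> - C" for L
    using p[OF that] unc that by auto
  have small: "countable (L \<inter> p L \<inter> F)" if "L \<in> \<E> - C" "F \<in> \<E>" "F \<noteq> L" "F \<noteq> p L" for L F
  proof (cases "p L = L")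
    case True
    then show ?thesis using p[OF that(1)] that by auto
  next
    case False
    then show ?thesis
      using triple_boundedD(1)[OF tb, of L "p L" F] that pE by (auto intro: countable_finite)
  qed
  \<comment> \<open>\<open>X\<close> contains a cover point chosen before stage
    \<open>A\<close>.\<close>
  define hit where "hit f A X \<longleftrightarrow> (\<exists>B\<in>\<E>. (B, A) \<in> R \<and> (\<exists>z. f B = Some z \<and> fst z \<in> X))"
    for f :: "'a set \<Rightarrow> ('a \<times> 'a set) option" and A X
  \<comment> \<open>A step \<open>Some (y, Q)\<close> puts \<open>y\<close> into the cover and reserves \<open>Q\<close> as the edge that
    meets the cover in \<open>y\<close> only. A centre is reserved only if each of its leaves has
    already been hit, so no later step can use it.\<close>
  define step where "step f A y Q L \<longleftrightarrow> L \<in> \<E> - C \<and> A \<in> {L, p L} \<and> y \<in> L \<inter> p L \<and>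
      (\<forall>B\<in>\<E>. (B, A) \<in> R \<longrightarrow> (\<forall>z. f B = Some z \<longrightarrow> snd z \<in> \<E> \<longrightarrow>
        snd z \<notin> {L, p L} \<longrightarrow> y \<notin> snd z)) \<and>
      (Q = L \<and> \<not> hit f A L \<or> Q = A \<and> A = p L \<and> A \<in> C \<and> (\<forall>L'\<in>\<E> - C. p L' = A \<longrightarrow> hit f A L'))"
    for f A y Q L
  \<comment> \<open>\<open>None\<close> records that \<open>A\<close> is already hit and adds no
    point. Outside \<open>\<E>\<close> the value is unconstrained, hence the restriction to
    \<open>B\<in>\<E>\<close> in \<open>hit\<close> and \<open>step\<close>.\<close>
  define P where "P f A res \<longleftrightarrow> A \<in> \<E> \<longrightarrow> (if hit f A A then res = None
      else \<exists>y Q L. res = Some (y, Q) \<and> step f A y Q L)" for f A res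
  have "\<exists>f. \<forall>A. P f A (f A)"
  proof (rule dependent_wf_choice[OF wf])
    fix f g :: "'a set \<Rightarrow> ('a \<times> 'a set) option" and A r assume "\<And>z. (z, A) \<in> R \<Longrightarrow> f z = g z"
    \<comment> \<open>\<open>hit\<close> and \<open>step\<close> read \<open>f\<close> only below
      \<open>A\<close>; these guarded equivalences let the congruence rules exchange
      \<open>f\<close> and \<open>g\<close> there.\<close>
    then have eq: "(z, A) \<in> R \<and> Q (f z) \<longleftrightarrow> (z, A) \<in> R \<and> Q (g z)"
      "((z, A) \<in> R \<longrightarrow> Q (f z)) \<longleftrightarrow> ((z, A) \<in> R \<longrightarrow> Q (g z))" for z Q
      by auto
    have "hit f A = hit g A"
      unfolding hit_def by (intro ext bex_cong refl eq)
    moreover from this have "step f A = step g A"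
      unfolding step_def by (intro ext conj_cong ball_cong disj_cong eq refl) simp_all
    ultimately show "P f A r = P g A r" unfolding P_def by simp
  next
    fix A and f :: "'a set \<Rightarrow> ('a \<times> 'a set) option"
    show "\<exists>r. P f A r"
    proof (cases "A \<in> \<E> \<and> \<not> hit f A A")
      case True
      \<comment> \<open>A non-centre reserves itself. A centre reserves one of its unhit leaves if
        there is one, and otherwise itself together with an arbitrary leaf as
        \<open>L\<close>.\<close>
      obtain L Q where L: "L \<in> \<E> - C" "A \<in> {L, p L}" and Q: "Q = L \<and> \<not> hit f A L \<or>
          Q = A \<and> A = p L \<and> A \<in> C \<and> (\<forall>L'\<in>\<E> - C. p L' = A \<longrightarrow> hit f A L')"
      proof (cases "A \<in> C")
        case AC: True
        then obtain L where "L \<in> \<E> - C" "p L = A" using onto by blast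
        then show ?thesis using AC that by (metis insertCI)
      next
        case False
        then show ?thesis using True that by blast
      qed
      \<comment> \<open>Where \<open>f B\<close> is \<open>None\<close>, \<open>the\<close> yields
        an arbitrary value; intersecting with \<open>\<E>\<close> ensures that \<open>N\<close>
        still consists of edges.\<close>
      define N where "N = (\<lambda>B. snd (the (f B))) ` {B\<in>\<E>. (B, A) \<in> R} \<inter> \<E> - {L, p L}"
      have "countable N" unfolding N_def using init True by auto
      then have "countable (\<Union>F\<in>N. L \<inter> p L \<inter> F)"
        using small L(1) unfolding N_def by (intro countable_UN) auto
      then have "\<not> L \<inter> p L \<subseteq> (\<Union>F\<in>N. L \<inter> p L \<inter> F)"
        using big[OF L(1)] countable_subset by blast
      then obtain y where y: "y \<in> L \<inter> p L" "\<And>F. F \<in> N \<Longrightarrow> y \<notin> F" by blast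
      have "y \<notin> snd z" if "B \<in> \<E>" "(B, A) \<in> R" "f B = Some z" "snd z \<in> \<E>" "snd z \<notin> {L, p L}" for B z
      proof (rule y(2))
        show "snd z \<in> N" unfolding N_def using that by force
      qed
      then have "step f A y Q L" unfolding step_def using L Q y(1) by blast
      then show ?thesis unfolding P_def using True by auto
    qed (auto simp: P_def)
  qed
  then obtain f where P: "\<And>A. P f A (f A)" by blast
  have st: "\<exists>L. step f A y Q L" and nhit: "\<not> hit f A A" if "A \<in> \<E>" "f A = Some (y, Q)" for A y Q
    using P[of A] that unfolding P_def by (auto split: if_splits)
  define Y where "Y = {y. \<exists>A\<in>\<E>. \<exists>Q. f A = Some (y, Q)}"
  have hitY: "Y \<inter> X \<noteq> {}" if "hit f A X" for A X
    using that unfolding hit_def Y_def by force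
  have hitI: "hit f A X" if "B \<in> \<E>" "(B, A) \<in> R" "f B = Some (y, Q)" "y \<in> X" for A B X y Q
    using that unfolding hit_def by force
  have hit_mono: "hit f B X" if "hit f A X" "(A, B) \<in> R" for A B X
    using that trans unfolding hit_def by (meson transD)
  have yQ: "y \<in> A" "y \<in> Q" "Q \<in> \<E>" "\<not> hit f A Q" if "A \<in> \<E>" "f A = Some (y, Q)" for A y Q
    using st[OF that] nhit[OF that] that pE unfolding step_def by auto
  have "minimal_vertex_cover \<E> Y"
  proof (rule minimal_vertex_coverI)
    show "Y \<subseteq> \<Union>\<E>" using yQ unfolding Y_def by blast
  next
    fix E assume E: "E \<in> \<E>"
    show "Y \<inter> E \<noteq> {}"
    proof (cases "hit f E E")
      case False
      then obtain y Q where "f E = Some (y, Q)" using P[of E] E unfolding P_def by auto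
      then show ?thesis using yQ(1) E unfolding Y_def by blast
    qed (rule hitY)
  next
    fix y assume "y \<in> Y"
    then obtain A Q where A: "A \<in> \<E>" "f A = Some (y, Q)" unfolding Y_def by blast
    \<comment> \<open>\<open>Q\<close> is private to \<open>y\<close>. An earlier point in
      \<open>Q\<close> is excluded because \<open>Q\<close> was not hit before \<open>A\<close>; a
      later one must come from a step whose \<open>L'\<close> or \<open>p L'\<close> is
      \<open>Q\<close>, since all other steps avoid \<open>Q\<close>.\<close>
    have "y' = y" if B: "B \<in> \<E>" "f B = Some (y', Q')" "y' \<in> Q" for B y' Q'
    proof (rule ccontr)
      assume "y' \<noteq> y"
      then have "A \<noteq> B" using A B by auto
      then consider "(B, A) \<in> R" | "(A, B) \<in> R" using total A B by blast
      then show False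
      proof cases
        case 1
        then show False using yQ(4)[OF A] hitI[OF B(1) 1 B(2,3)] by blast
      next
        case 2
        note hitB = hitI[OF A(1) 2 A(2)]
        obtain L where L: "step f A y Q L" using st A by blast
        obtain L' where L': "step f B y' Q' L'" using st B by blast
        have "\<not> hit f B B" using nhit B by blast
        then have "y \<notin> B" using hitB by blast
        have "Q \<in> {L', p L'}"
          using L' A 2 B(3) yQ(3)[OF A] unfolding step_def by fastforce
        then show False
        proof
          \<comment> \<open>\<open>L'\<close> is already hit through \<open>y\<close>, so stage
            \<open>B\<close> must be a centre reserving itself. Then \<open>y\<close> lies in
            \<open>L' \<inter> p L'\<close> and hence in \<open>B\<close>, which was supposed to be
            unhit.\<close>
          assume "Q = L'"
          then have "B = p L'" "B \<in> C" "Q \<notin> C" "Q = L"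
            using L L' \<open>y \<notin> B\<close> hitB[of L'] yQ(2)[OF A] unfolding step_def by auto
          then show False using L \<open>Q = L'\<close> \<open>y \<notin> B\<close> unfolding step_def by auto
        next
          \<comment> \<open>Here \<open>B\<close> is a leaf of the centre \<open>Q\<close>. As
            \<open>Q\<close> reserved itself, all its leaves were hit before \<open>A\<close>, hence
            \<open>B\<close> was hit before its own stage.\<close>
          assume "Q \<in> {p L'}"
          then have "Q \<noteq> B" "Q = p L'" "L' \<in> \<E> - C"
            using \<open>y \<notin> B\<close> yQ(2)[OF A] L' unfolding step_def by auto
          then have "B = L'" using L' unfolding step_def by auto
          then have "Q \<in> C" using p[OF \<open>L' \<in> \<E> - C\<close>] \<open>Q \<noteq> B\<close> \<open>Q = p L'\<close> by auto
          then have "hit f A L'"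
            using L \<open>Q = p L'\<close> \<open>L' \<in> \<E> - C\<close> unfolding step_def by auto
          then show False using hit_mono 2 \<open>B = L'\<close> \<open>\<not> hit f B B\<close> by blast
        qed
      qed
    qed
    then have "Y \<inter> Q = {y}" using A yQ(2)[OF A] unfolding Y_def by blast
    then show "\<exists>E\<in>\<E>. Y \<inter> E = {y}" using yQ(3)[OF A] by blast
  qed
  then show ?thesis ..
qed


section \<open>Gluing well-ordered blocks\<close>

text \<open>Stage \<open>i\<close> covers the new edges not hit before, using points outside all
  earlier edges. Thus later stages never touch the private edges of earlier ones. The set
  \<open>S\<close> in the assumption is arbitrary because the edges still to be covered depend on
  the previous choices.\<close>

lemma minimal_vertex_cover_blocks:
  fixes D :: "'i \<Rightarrow> 'a set set"
  assumes wf: "wf R"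
    and total: "\<And>i j. i \<in> I \<Longrightarrow> j \<in> I \<Longrightarrow> i \<noteq> j \<Longrightarrow> (i, j) \<in> R \<or> (j, i) \<in> R"
    and ex: "\<And>i S. i \<in> I \<Longrightarrow> S \<subseteq> D i - (\<Union>j\<in>{j\<in>I. (j, i) \<in> R}. D j) \<Longrightarrow>
      \<exists>Y. minimal_vertex_cover ((\<lambda>E. E - \<Union>(\<Union>j\<in>{j\<in>I. (j, i) \<in> R}. D j)) ` S) Y"
  shows "\<exists>Y. minimal_vertex_cover (\<Union>i\<in>I. D i) Y"
proof -
  define U where "U i = (\<Union>j\<in>{j\<in>I. (j, i) \<in> R}. D j)" for i
  define S where "S f i = {E \<in> D i - U i. \<forall>j\<in>I. (j, i) \<in> R \<longrightarrow> E \<inter> f j = {}}"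
    for f :: "'i \<Rightarrow> 'a set" and i
  define P where "P f i Y \<longleftrightarrow> (i \<in> I \<longrightarrow> minimal_vertex_cover ((\<lambda>E. E - \<Union>(U i)) ` S f i) Y)" for f i Y
  have "\<exists>f. \<forall>i. P f i (f i)"
  proof (rule dependent_wf_choice[OF wf])
    fix f g :: "'i \<Rightarrow> 'a set" and i r assume "\<And>j. (j, i) \<in> R \<Longrightarrow> f j = g j"
    then have "S f i = S g i" unfolding S_def by auto
    then show "P f i r = P g i r" unfolding P_def by simp
  next
    fix i and f :: "'i \<Rightarrow> 'a set"
    show "\<exists>r. P f i r"
    proof (cases "i \<in> I")
      case True
      have "S f i \<subseteq> D i - U i" unfolding S_def by blast
      then show ?thesis using ex[OF True] unfolding P_def U_def by blast
    qed (simp add: P_def)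
  qed
  then obtain f where f: "\<And>i. i \<in> I \<Longrightarrow> minimal_vertex_cover ((\<lambda>E. E - \<Union>(U i)) ` S f i) (f i)"
    unfolding P_def by blast
  have fsub: "f i \<subseteq> \<Union>(D i)" "f i \<inter> \<Union>(U i) = {}" if "i \<in> I" for i
    using minimal_vertex_coverD(1)[OF f[OF that]] unfolding S_def by auto
  have "minimal_vertex_cover (\<Union>i\<in>I. D i) (\<Union>i\<in>I. f i)"
  proof (rule minimal_vertex_coverI)
    show "(\<Union>i\<in>I. f i) \<subseteq> \<Union>(\<Union>i\<in>I. D i)" using fsub(1) by blast
  next
    fix E assume "E \<in> (\<Union>i\<in>I. D i)"
    \<comment> \<open>The first block containing \<open>E\<close>: there \<open>E\<close> is new,
      and it is either hit already or covered at this stage.\<close>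
    obtain i where i: "i \<in> I" "E \<in> D i" "\<And>j. (j, i) \<in> R \<Longrightarrow> \<not> (j \<in> I \<and> E \<in> D j)"
    proof -
      obtain i0 where "i0 \<in> {i\<in>I. E \<in> D i}" using \<open>E \<in> (\<Union>i\<in>I. D i)\<close> by blast
      from wfE_min[OF wf this] show thesis by (metis (mono_tags, lifting) mem_Collect_eq that)
    qed
    then have "E \<in> D i - U i" unfolding U_def by blast
    show "(\<Union>i\<in>I. f i) \<inter> E \<noteq> {}"
    proof (cases "E \<in> S f i")
      case True
      then show ?thesis using minimal_vertex_coverD(2)[OF f[OF i(1)], of "E - \<Union>(U i)"] i(1) by blast
    next
      case False
      then show ?thesis using \<open>E \<in> D i - U i\<close> unfolding S_def by blast
    qed
  next
    fix y assume "y \<in> (\<Union>i\<in>I. f i)"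
    then obtain i where i: "i \<in> I" "y \<in> f i" by blast
    then obtain E where E: "E \<in> S f i" "f i \<inter> (E - \<Union>(U i)) = {y}"
      using minimal_vertex_coverD(3)[OF f[OF i(1)]] by blast
    have "f j \<inter> E = {}" if "j \<in> I" "j \<noteq> i" for j
      using total[OF that(1) i(1) that(2)]
    proof
      assume "(j, i) \<in> R"
      then show ?thesis using E(1) that unfolding S_def by blast
    next
      assume "(i, j) \<in> R"
      then have "E \<in> U j" using E(1) i(1) unfolding S_def U_def by blast
      then show ?thesis using fsub(2)[OF that(1)] by blast
    qed
    moreover have "f i \<inter> E = {y}" using E fsub(2)[OF i(1)] by blast
    ultimately have "(\<Union>i\<in>I. f i) \<inter> E = {y}" using i(1) by blast
    moreover have "E \<in> (\<Union>i\<in>I. D i)" using E(1) i(1) unfolding S_def by blast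
    ultimately show "\<exists>E\<in>(\<Union>i\<in>I. D i). (\<Union>i\<in>I. f i) \<inter> E = {y}" by blast
  qed
  then show ?thesis ..
qed

section \<open>Closed subfamilies\<close>

lemma card_of_subsets_of_size:
  assumes "Card_order r" "\<not> finite (Field r)" "|A| \<le>o r"
  shows "|{K. K \<subseteq> A \<and> finite K \<and> card K = k}| \<le>o r"
proof (induction k)
  case 0
  have "{K. K \<subseteq> A \<and> finite K \<and> card K = 0} = {{}}" by auto
  then show ?case using card_of_singl_ordLeq[of "Field r" "{}"] assms
    by (metis Card_order_singl_ordLeq finite.emptyI)
next
  case (Suc k)
  let ?S = "{K. K \<subseteq> A \<and> finite K \<and> card K = k}"
  have "{K. K \<subseteq> A \<and> finite K \<and> card K = Suc k} \<subseteq> (\<lambda>(x, K). insert x K) ` (A \<times> ?S)"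
  proof
    fix K assume K: "K \<in> {K. K \<subseteq> A \<and> finite K \<and> card K = Suc k}"
    then have "card K = Suc k" by simp
    then obtain x K' where "K = insert x K'" "x \<notin> K'" "card K' = k"
      by (auto simp: card_Suc_eq)
    then show "K \<in> (\<lambda>(x, K). insert x K) ` (A \<times> ?S)" using K by force
  qed
  then have "|{K. K \<subseteq> A \<and> finite K \<and> card K = Suc k}| \<le>o |A \<times> ?S|"
    by (meson card_of_image card_of_mono1 ordLeq_transitive)
  also have "|A \<times> ?S| \<le>o r"
    using card_of_Times_ordLeq_infinite_Field assms Suc by blast
  finally show ?case .
qed

text \<open>The set \<open>K\<close> replaces a bound on \<open>card (F \<inter> \<Union>B)\<close>,
  which would be 0 for an infinite intersection.\<close>

definition point_closed :: "nat \<Rightarrow> 'a set set \<Rightarrow> 'a set set \<Rightarrow> bool"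
  where "point_closed k \<E> B \<longleftrightarrow> B \<subseteq> \<E> \<and>
    (\<forall>F\<in>\<E>. \<forall>K. K \<subseteq> F \<inter> \<Union>B \<longrightarrow> finite K \<longrightarrow> card K = k \<longrightarrow> F \<in> B)"

definition point_closure :: "nat \<Rightarrow> 'a set set \<Rightarrow> 'a set set \<Rightarrow> 'a set set"
  where "point_closure k \<E> A = \<Inter>{B. point_closed k \<E> B \<and> A \<subseteq> B}"

lemma finite_inter_point_closed:
  assumes "point_closed k \<E> B" "F \<in> \<E> - B"
  shows "finite (F \<inter> \<Union>B)"
proof (rule ccontr)
  assume "infinite (F \<inter> \<Union>B)"
  then obtain K where "K \<subseteq> F \<inter> \<Union>B" "finite K" "card K = k"
    using infinite_arbitrarily_large by metis
  then show False using assms unfolding point_closed_def by blast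
qed

text \<open>A finite set of points below the chain lies below one member. Since
  \<open>k > 0\<close>, the set is nonempty, which excludes the empty chain.\<close>

lemma point_closed_Union_chain:
  assumes "\<And>B. B \<in> \<C> \<Longrightarrow> point_closed k \<E> B" "subset.chain UNIV \<C>" "k > 0"
  shows "point_closed k \<E> (\<Union>\<C>)"
  unfolding point_closed_def
proof (intro conjI ballI allI impI)
  show "\<Union>\<C> \<subseteq> \<E>" using assms(1) unfolding point_closed_def by blast
  fix F K assume F: "F \<in> \<E>" and K: "K \<subseteq> F \<inter> \<Union>(\<Union>\<C>)" "finite K" "card K = k"
  have "K \<noteq> {}" using K assms(3) by auto
  then have "Union ` \<C> \<noteq> {}" using K by blast
  moreover have "subset.chain UNIV (Union ` \<C>)"
  proof -
    have "\<Union>X \<subseteq> \<Union>X' \<or> \<Union>X' \<subseteq> \<Union>X" if "X \<in> \<C>" "X' \<in> \<C>" for X X'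
      using assms(2) that Union_mono unfolding subset_chain_def by metis
    then show ?thesis unfolding subset_chain_def by auto
  qed
  moreover have "K \<subseteq> \<Union>(Union ` \<C>)" using K by blast
  ultimately obtain V where "V \<in> Union ` \<C>" "K \<subseteq> V"
    using finite_subset_Union_chain[OF K(2)] by metis
  then obtain B where "B \<in> \<C>" "K \<subseteq> \<Union>B" by blast
  then have "K \<subseteq> F \<inter> \<Union>B" using K by blast
  then have "F \<in> B" using assms(1)[OF \<open>B \<in> \<C>\<close>] F K(2,3) unfolding point_closed_def by metis
  then show "F \<in> \<Union>\<C>" using \<open>B \<in> \<C>\<close> by blast
qed

lemma point_closed_point_closure:
  assumes "A \<subseteq> \<E>"
  shows "point_closed k \<E> (point_closure k \<E> A)" "A \<subseteq> point_closure k \<E> A"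
proof -
  \<comment> \<open>\<open>\<E>\<close> is itself a candidate, so the intersection defining the
    closure stays inside \<open>\<E>\<close>.\<close>
  have E: "point_closed k \<E> \<E>" unfolding point_closed_def by blast
  show "point_closed k \<E> (point_closure k \<E> A)"
    unfolding point_closed_def[of _ _ "point_closure k \<E> A"]
  proof (intro conjI ballI allI impI)
    show "point_closure k \<E> A \<subseteq> \<E>" using E assms unfolding point_closure_def by blast
    fix F K assume F: "F \<in> \<E>" and K: "K \<subseteq> F \<inter> \<Union>(point_closure k \<E> A)" "finite K" "card K = k"
    show "F \<in> point_closure k \<E> A"
      unfolding point_closure_def
    proof
      fix B assume B: "B \<in> {B. point_closed k \<E> B \<and> A \<subseteq> B}"
      then have "point_closure k \<E> A \<subseteq> B" unfolding point_closure_def by blast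
      then have "K \<subseteq> F \<inter> \<Union>B" using K by blast
      then show "F \<in> B" using B F K unfolding point_closed_def by blast
    qed
  qed
  show "A \<subseteq> point_closure k \<E> A" unfolding point_closure_def by blast
qed

lemma point_closure_mono: "A \<subseteq> A' \<Longrightarrow> point_closure k \<E> A \<subseteq> point_closure k \<E> A'"
  unfolding point_closure_def by blast

text \<open>The closure is reached from below by iterating \<open>T\<close> countably often. One
  application adds finitely many edges for each \<open>k\<close>-set of points, and an infinite
  cardinal \<open>r\<close> absorbs all of this.\<close>

lemma card_of_point_closure:
  fixes \<E> :: "'a set set"
  assumes tb: "triple_bounded k \<E>" and r: "Card_order r" "\<not> finite (Field r)"
    and edges: "\<And>E. E \<in> \<E> \<Longrightarrow> |E| \<le>o r" and A: "A \<subseteq> \<E>" "|A| \<le>o r"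
  shows "|point_closure k \<E> A| \<le>o r"
proof -
  define T where "T B = B \<union> (\<Union>K\<in>{K. K \<subseteq> \<Union>B \<and> finite K \<and> card K = k}. {F\<in>\<E>. K \<subseteq> F})" for B
  \<comment> \<open>Three distinct edges containing \<open>K\<close> would have at least
    \<open>k\<close> common points.\<close>
  have fin: "finite {F\<in>\<E>. K \<subseteq> F}" if "card K = k" for K
  proof (rule ccontr)
    assume "infinite {F\<in>\<E>. K \<subseteq> F}"
    from infinite_arbitrarily_large[OF this, of 3]
    obtain X where X: "X \<subseteq> {F\<in>\<E>. K \<subseteq> F}" "finite X" "card X = 3" by blast
    then obtain F G H where FGH: "X = {F, G, H}" "F \<noteq> G" "F \<noteq> H" "G \<noteq> H"
      by (metis card_3_iff)
    then have "K \<subseteq> F \<inter> G \<inter> H" "F \<in> \<E>" "G \<in> \<E>" "H \<in> \<E>" using X by auto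
    then show False
      using triple_boundedD[OF tb, of F G H] FGH that card_mono[of "F \<inter> G \<inter> H" K] by simp
  qed
  have finr: "|X| \<le>o r" if "finite X" for X :: "'a set set"
    using that r by (metis card_of_Well_order card_order_on_well_order_on finite_ordLess_infinite
        card_of_Field_ordIso Field_card_of ordLess_imp_ordLeq)
  have T: "T B \<subseteq> \<E> \<and> |T B| \<le>o r" if "B \<subseteq> \<E> \<and> |B| \<le>o r" for B
  proof
    show "T B \<subseteq> \<E>" using that unfolding T_def by blast
    have "|\<Union>B| \<le>o r"
      using card_of_UNION_ordLeq_infinite_Field[OF r(2,1), of B "\<lambda>E. E"] that edges by auto
    then have "|\<Union>K\<in>{K. K \<subseteq> \<Union>B \<and> finite K \<and> card K = k}. {F\<in>\<E>. K \<subseteq> F}| \<le>o r"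
      using card_of_subsets_of_size[OF r] fin finr
      by (intro card_of_UNION_ordLeq_infinite_Field[OF r(2,1)]) auto
    then show "|T B| \<le>o r" unfolding T_def using that r
      by (intro card_of_Un_ordLeq_infinite_Field) auto
  qed
  define C where "C = (\<Union>n. (T ^^ n) A)"
  have Tn: "(T ^^ n) A \<subseteq> \<E> \<and> |(T ^^ n) A| \<le>o r" for n
    by (induction n) (use A T in auto)
  have "|UNIV :: nat set| \<le>o r"
    using r(2) infinite_iff_card_of_nat card_of_Field_ordIso[OF r(1)] ordLeq_ordIso_trans by metis
  then have "|C| \<le>o r"
    unfolding C_def using Tn by (intro card_of_UNION_ordLeq_infinite_Field[OF r(2,1)]) auto
  have "point_closed k \<E> C"
    unfolding point_closed_def
  proof (intro conjI ballI allI impI)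
    show "C \<subseteq> \<E>" using Tn unfolding C_def by blast
    fix F K assume F: "F \<in> \<E>" and K: "K \<subseteq> F \<inter> \<Union>C" "finite K" "card K = k"
    \<comment> \<open>The iterates increase, so a finite \<open>K\<close> lies below a single one,
      and \<open>F\<close> enters at the next.\<close>
    have mono: "(T ^^ m) A \<subseteq> (T ^^ n) A" if "m \<le> n" for m n
      using that by (rule lift_Suc_mono_le[of "\<lambda>n. (T ^^ n) A", rotated]) (auto simp: T_def)
    have "subset.chain UNIV (range (\<lambda>n. \<Union>((T ^^ n) A)))"
      unfolding subset_chain_def using mono by (auto, meson UnionI nat_le_linear subsetD)
    moreover have "K \<subseteq> \<Union>(range (\<lambda>n. \<Union>((T ^^ n) A)))" using K unfolding C_def by blast
    ultimately obtain V where "V \<in> range (\<lambda>n. \<Union>((T ^^ n) A))" "K \<subseteq> V"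
      using finite_subset_Union_chain[OF K(2)] by (metis UNIV_not_empty image_is_empty)
    then obtain n where "K \<subseteq> \<Union>((T ^^ n) A)" by blast
    then have "F \<in> (T ^^ Suc n) A" using K F unfolding T_def by auto
    then show "F \<in> C" unfolding C_def by blast
  qed
  moreover have "A \<subseteq> C" unfolding C_def by (metis UN_upper UNIV_I funpow_0)
  ultimately have "point_closure k \<E> A \<subseteq> C" unfolding point_closure_def by blast
  then show ?thesis using \<open>|C| \<le>o r\<close> card_of_mono1 ordLeq_transitive by blast
qed

section \<open>The induction on the number of edges\<close>

lemma Card_order_omega1: "Card_order \<omega>\<^sub>1"
  using cardSuc_Card_order natLeq_Card_order by blast

lemma infinite_Field_omega1: "\<not> finite (Field \<omega>\<^sub>1)"
  using cardSuc_finite natLeq_Card_order Field_natLeq by (metis infinite_UNIV_nat)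

lemma countable_if_less_omega1: "|A| <o \<omega>\<^sub>1 \<Longrightarrow> countable A"
  using cardSuc_ordLeq_ordLess[OF natLeq_Card_order card_of_Card_order] countable_card_le_natLeq
  by blast

lemma uncountable_if_eq_omega1:
  assumes "|A| =o \<omega>\<^sub>1"
  shows "uncountable A"
proof
  assume "countable A"
  then have "|A| \<le>o natLeq" by (simp add: countable_card_le_natLeq)
  then have "|A| <o \<omega>\<^sub>1"
    using cardSuc_ordLeq_ordLess[OF natLeq_Card_order card_of_Card_order] by blast
  then show False using assms not_ordLess_ordIso by blast
qed

text \<open>Well-founded induction on the cardinal of \<open>\<E>\<close>. Being uncountable and of
  size at most \<open>\<omega>\<^sub>1\<close> survives the removal of finitely many points, as
  truncation requires.\<close>

lemma minimal_vertex_cover_if_triple_bounded: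
  fixes \<E> :: "'a set set"
  assumes "k > 0" "triple_bounded k \<E>"
    and "\<And>E. E \<in> \<E> \<Longrightarrow> uncountable E" "\<And>E. E \<in> \<E> \<Longrightarrow> |E| \<le>o \<omega>\<^sub>1"
  shows "\<exists>Y. minimal_vertex_cover \<E> Y"
  using assms
proof (induction "|\<E>|" arbitrary: \<E> rule: wf_induct_rule[OF wf_ordLess])
  case (1 \<E>)
  note tb = \<open>triple_bounded k \<E>\<close>
  note edges = \<open>\<And>E. E \<in> \<E> \<Longrightarrow> uncountable E\<close> \<open>\<And>E. E \<in> \<E> \<Longrightarrow> |E| \<le>o \<omega>\<^sub>1\<close>
  \<comment> \<open>The strict part of a well-order of minimal type, so that proper initial segments
    have fewer elements than \<open>\<E>\<close>.\<close>
  define R where "R = |\<E>| - Id"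
  have wo: "Well_order |\<E>|" by (rule card_of_Well_order)
  have FR: "Field |\<E>| = \<E>" by (rule Field_card_of)
  have wf: "wf R" using wo unfolding R_def well_order_on_def by blast
  have trans: "trans R"
    using wo unfolding R_def order_on_defs by (blast intro: trans_diff_Id)
  have total: "(A, B) \<in> R \<or> (B, A) \<in> R" if "A \<in> \<E>" "B \<in> \<E>" "A \<noteq> B" for A B
    using wo that FR unfolding R_def order_on_defs total_on_def by auto
  have init: "|{B\<in>\<E>. (B, A) \<in> R}| <o |\<E>|" if "A \<in> \<E>" for A
  proof -
    have "{B\<in>\<E>. (B, A) \<in> R} = underS |\<E>| A"
      using FR unfolding underS_def R_def Field_def by auto
    then show ?thesis using card_of_underS[OF card_of_Card_order] that FR by metis
  qed
  show ?case
  proof (cases "|\<E>| \<le>o \<omega>\<^sub>1")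
    case True
    have "countable {B\<in>\<E>. (B, A) \<in> R}" if "A \<in> \<E>" for A
      using init[OF that] True ordLess_ordLeq_trans countable_if_less_omega1 by blast
    then show ?thesis
      using minimal_vertex_cover_countable_initial_segments[OF wf trans total _ edges(1) tb] by blast
  next
    case False
    then have less: "\<omega>\<^sub>1 <o |\<E>|"
      using Card_order_omega1 card_of_Well_order not_ordLeq_iff_ordLess
        card_order_on_well_order_on by blast
    define D where "D G = point_closure k \<E> (insert G {B\<in>\<E>. (B, G) \<in> R})" for G
    have closed: "point_closed k \<E> (D G)" and inD: "G \<in> D G" if "G \<in> \<E>" for G
      using point_closed_point_closure[of "insert G {B\<in>\<E>. (B, G) \<in> R}" \<E> k] that
      unfolding D_def by auto
    have D_mono: "D G \<subseteq> D H" if "(G, H) \<in> R" "G \<in> \<E>" for G H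
      unfolding D_def using that trans by (intro point_closure_mono) (auto dest: transD)
    have D_less: "|D G| <o |\<E>|" if "G \<in> \<E>" for G
    proof -
      let ?A = "{B\<in>\<E>. (B, G) \<in> R}"
      \<comment> \<open>Applied to the larger of \<open>\<omega>\<^sub>1\<close> and
        \<open>|?A|\<close>; these are relations on different types, so \<open>r\<close> has a type
        of its own.\<close>
      have bound: "|D G| \<le>o r" if r: "Card_order r" "\<omega>\<^sub>1 \<le>o r" "|?A| \<le>o r" for r :: "'b rel"
      proof -
        have inf: "\<not> finite (Field r)"
          using r infinite_Field_omega1 card_of_ordLeq_finite card_of_mono2 by blast
        have "|{G}| \<le>o r"
          using inf r by (metis Card_order_singl_ordLeq finite.emptyI)
        then have "|{G} \<union> ?A| \<le>o r"
          using card_of_Un_ordLeq_infinite_Field[OF inf] r by blast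
        then show ?thesis
          unfolding D_def using \<open>G \<in> \<E>\<close> ordLeq_transitive[OF edges(2) r(2)]
          by (intro card_of_point_closure[OF tb r(1) inf]) auto
      qed
      show ?thesis
      proof (cases "|?A| \<le>o \<omega>\<^sub>1")
        case True
        then have "|D G| \<le>o \<omega>\<^sub>1"
          using bound[OF Card_order_omega1] Card_order_omega1 ordLeq_reflexive
            card_order_on_well_order_on by blast
        then show ?thesis using less ordLeq_ordLess_trans by blast
      next
        case False
        then have "\<omega>\<^sub>1 \<le>o |?A|"
          using Card_order_omega1 card_of_Well_order not_ordLeq_iff_ordLess
            card_order_on_well_order_on ordLess_imp_ordLeq by blast
        then have "|D G| \<le>o |?A|"
          using bound[of "|?A|"] card_of_Card_order card_of_mono1 by blast
        then show ?thesis using init[OF \<open>G \<in> \<E>\<close>] ordLeq_ordLess_trans by blast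
      qed
    qed
    have "\<exists>Y. minimal_vertex_cover (\<Union>G\<in>\<E>. D G) Y"
    proof (rule minimal_vertex_cover_blocks[OF wf total])
      fix G S
      let ?B = "\<Union>H\<in>{H\<in>\<E>. (H, G) \<in> R}. D H"
      assume G: "G \<in> \<E>" and S: "S \<subseteq> D G - ?B"
      have SE: "S \<subseteq> \<E>" using S closed[OF G] unfolding point_closed_def by blast
      \<comment> \<open>The earlier blocks form a chain, so their union is closed and every edge of
        \<open>S\<close> loses only finitely many points.\<close>
      have "subset.chain UNIV (D ` {H\<in>\<E>. (H, G) \<in> R})"
        unfolding subset_chain_def using total D_mono by (auto, blast)
      then have "point_closed k \<E> ?B"
        using point_closed_Union_chain[of "D ` {H\<in>\<E>. (H, G) \<in> R}"] closed 1 by auto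
      then have fin: "finite (E \<inter> \<Union>?B)" if "E \<in> S" for E
        using finite_inter_point_closed S SE that by blast
      show "\<exists>Y. minimal_vertex_cover ((\<lambda>E. E - \<Union>?B) ` S) Y"
      proof (rule 1(1))
        have "|S| \<le>o |D G|" using S by (intro card_of_mono1) blast
        then show "( |(\<lambda>E. E - \<Union>?B) ` S|, |\<E>| ) \<in> ordLess"
          using D_less[OF G] card_of_image ordLeq_transitive ordLeq_ordLess_trans by blast
        show "triple_bounded k ((\<lambda>E. E - \<Union>?B) ` S)"
          by (rule triple_bounded_truncate[OF tb SE])
        fix E' assume "E' \<in> (\<lambda>E. E - \<Union>?B) ` S"
        then obtain E where E: "E \<in> S" "E' = E - E \<inter> \<Union>?B" by blast
        show "uncountable E'"
          unfolding E(2) using edges(1) fin[OF E(1)] E(1) SE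
          by (intro uncountable_minus_countable countable_finite) blast+
        have "|E'| \<le>o |E|" using E by (intro card_of_mono1) blast
        then show "|E'| \<le>o \<omega>\<^sub>1" using edges(2) E(1) SE ordLeq_transitive by blast
      qed (use 1 in simp)
    qed
    moreover have "(\<Union>G\<in>\<E>. D G) = \<E>"
    proof
      show "(\<Union>G\<in>\<E>. D G) \<subseteq> \<E>" using closed unfolding point_closed_def by blast
      show "\<E> \<subseteq> (\<Union>G\<in>\<E>. D G)" using inD by blast
    qed
    ultimately show ?thesis by simp
  qed
qed

theorem theorem1p5:
  fixes lam :: "'a rel" and k :: nat and \<E> :: "'a set set"
  assumes "Card_order lam"
    and "\<omega>\<^sub>1 \<le>o lam"
    and "hypergraph \<E>"
    and "\<E> \<subseteq> subsets_of_card lam \<omega>\<^sub>1"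
    and "property_C |{..<3::nat}| |{..<k}| \<E>"
  shows "\<exists>Y. minimal_vertex_cover \<E> Y"
\<comment> \<open>\<open>Suc k\<close>, because unions of chains of \<open>k\<close>-closed families need not be closed for \<open>k = 0\<close>.\<close>
proof (rule minimal_vertex_cover_if_triple_bounded[of "Suc k"])
  show "triple_bounded (Suc k) \<E>"
    using triple_bounded_mono[OF triple_bounded_if_property_C[OF assms(5)]] by simp
  fix E assume "E \<in> \<E>"
  then have "|E| =o \<omega>\<^sub>1" using assms(4) unfolding subsets_of_card_def by blast
  then show "uncountable E" "|E| \<le>o \<omega>\<^sub>1"
    using uncountable_if_eq_omega1 ordIso_iff_ordLeq by blast+
qed simp

end
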